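(* Let $\rho$ be a smooth, strictly positive density on a domain $V\subset\mathbb{R}^3$, let $\mathcal{E}(\rho)=\int_V \rho\ln\rho\,d^3x$, and let $\phi$ be a smooth potential on $V$. Let $(\rho_s)$ be a smooth curve of strictly positive densities with $\rho_0=\rho$, generated by smooth velocity potentials $\phi_s$ with $\phi_0=\phi$, that is, $\partial_s\rho_s+\nabla\cdot(\rho_s\nabla\phi_s)=0$. Assume the boundary conditions described in the context. Then the first variation of $\mathcal{E}$ along the displacement is $$\left.\frac{d}{ds}\mathcal{E}(\rho_s)\right|_{s=0}=\int_V \rho\,\nabla(\ln\rho)\cdot\nabla\phi\,d^3x,$$ i.e. the Wasserstein gradient of $\mathcal{E}$ at $\rho$ is represented by the potential $\ln\rho$. Moreover, the associated entropy force $F_i=-\partial_i\ln\rho$ ($i=1,2,3$) satisfies, at every point of $V$, $$\partial_jF_i=H_{ij},\qquad H_{ij}:=-\partial_i\partial_j\ln\rho\qquad(i,j\in\{1,2,3\}).$$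
   Context: A tangent vector at $\rho$ in Wasserstein space is a mass-conserving perturbation $\dot\rho=-\nabla\cdot(\rho\nabla\phi)$ generated by a velocity potential $\phi$. The statement that a potential $\psi$ represents the Wasserstein gradient of a functional $\mathcal{E}$ at $\rho$ means that the first variation of $\mathcal{E}$ along every such perturbation equals $\int_V\rho\,\nabla\psi\cdot\nabla\phi\,d^3x$. Boundary conditions: either $V$ is a periodic box and all functions are periodic, or the functions decay sufficiently rapidly at the boundary (or at infinity) that $\frac{d}{ds}\int_V\rho_s\ln\rho_s\,d^3x\big|_{s=0}=\int_V(1+\ln\rho)\,\partial_s\rho_s|_{s=0}\,d^3x$ and $\int_V\nabla\cdot\big((1+\ln\rho)\rho\nabla\phi\big)\,d^3x=0$, with all integrals involved absolutely convergent. *)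

theory Defs
  imports "HOL-Analysis.Analysis"
begin

section \<open>Differential operators\<close>

definition partial_deriv :: "3 \<Rightarrow> (real^3 \<Rightarrow> real) \<Rightarrow> real^3 \<Rightarrow> real" where
  "partial_deriv i f x = deriv (\<lambda>t. f (x + t *\<^sub>R axis i 1)) 0"

definition grad :: "(real^3 \<Rightarrow> real) \<Rightarrow> real^3 \<Rightarrow> real^3" where
  "grad f x = (\<chi> i. partial_deriv i f x)"

definition divergence :: "(real^3 \<Rightarrow> real^3) \<Rightarrow> real^3 \<Rightarrow> real" where
  "divergence F x = (\<Sum>i\<in>UNIV. partial_deriv i (\<lambda>y. F y $ i) x)"

text \<open>Continuous differentiability of order \<open>n\<close>, meant for open \<open>S\<close>: all iterated directional
  derivatives up to order \<open>n\<close> are continuous on \<open>S\<close>, and those of order less than \<open>n\<close> are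
  (totally) differentiable there.\<close>

primrec Ck_on :: "nat \<Rightarrow> 'a::real_normed_vector set \<Rightarrow> ('a \<Rightarrow> real) \<Rightarrow> bool" where
  "Ck_on 0 S f \<longleftrightarrow> continuous_on S f"
| "Ck_on (Suc n) S f \<longleftrightarrow>
     (\<forall>x\<in>S. f differentiable (at x)) \<and>
     (\<forall>v. Ck_on n S (\<lambda>x. frechet_derivative f (at x) v))"

definition smooth_on :: "'a::real_normed_vector set \<Rightarrow> ('a \<Rightarrow> real) \<Rightarrow> bool" where
  "smooth_on S f \<longleftrightarrow> (\<forall>n. Ck_on n S f)"


section \<open>Spatial domains\<close>

text \<open>\<open>Periodic_Box a b\<close> is the box with opposite corners \<open>a\<close> and \<open>b\<close> and opposite faces
  identified. A function on it is a function on the whole of \<open>\<real>\<^sup>3\<close> having period \<open>b $ i - a $ i\<close> in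
  the \<open>i\<close>-th coordinate. Accordingly \<open>cell\<close> is the set \<open>V\<close> over which one integrates, whereas
  \<open>region\<close> is the open set on which the functions live and where regularity, positivity and the
  continuity equation are required; for an ordinary domain the two coincide.\<close>

datatype spatial_domain =
    Domain "(real^3) set"
  | Periodic_Box "real^3" "real^3"

primrec is_spatial_domain :: "spatial_domain \<Rightarrow> bool" where
  "is_spatial_domain (Domain V) \<longleftrightarrow> open V \<and> connected V \<and> V \<noteq> {}"
| "is_spatial_domain (Periodic_Box a b) \<longleftrightarrow> (\<forall>i. a $ i < b $ i)"

primrec cell :: "spatial_domain \<Rightarrow> (real^3) set" where
  "cell (Domain V) = V"
| "cell (Periodic_Box a b) = cbox a b"

primrec region :: "spatial_domain \<Rightarrow> (real^3) set" where
  "region (Domain V) = V"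
| "region (Periodic_Box a b) = UNIV"

definition box_periodic :: "real^3 \<Rightarrow> real^3 \<Rightarrow> (real^3 \<Rightarrow> real) \<Rightarrow> bool" where
  "box_periodic a b f \<longleftrightarrow> (\<forall>i x. f (x + axis i (b $ i - a $ i)) = f x)"


section \<open>Curves of densities\<close>

definition smooth_density :: "spatial_domain \<Rightarrow> (real^3 \<Rightarrow> real) \<Rightarrow> bool" where
  "smooth_density V \<rho> \<longleftrightarrow> smooth_on (region V) \<rho> \<and> (\<forall>x\<in>region V. 0 < \<rho> x)"

text \<open>The curve is defined on an open interval \<open>J\<close> of parameters around \<open>0\<close>. It is smooth jointly
  in \<open>(s, x)\<close>; the potentials only need to be smooth in \<open>x\<close> for each \<open>s\<close>.\<close>

definition displacement ::
  "spatial_domain \<Rightarrow> real set \<Rightarrow> (real \<Rightarrow> real^3 \<Rightarrow> real) \<Rightarrow> (real \<Rightarrow> real^3 \<Rightarrow> real) \<Rightarrow> bool" where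
  "displacement V J \<rho>s \<phi>s \<longleftrightarrow>
     open J \<and> is_interval J \<and> 0 \<in> J \<and>
     smooth_on (J \<times> region V) (\<lambda>(s, x). \<rho>s s x) \<and>
     (\<forall>s\<in>J. smooth_density V (\<rho>s s)) \<and>
     (\<forall>s\<in>J. smooth_on (region V) (\<phi>s s)) \<and>
     (\<forall>s\<in>J. \<forall>x\<in>region V.
        deriv (\<lambda>t. \<rho>s t x) s + divergence (\<lambda>y. \<rho>s s y *\<^sub>R grad (\<phi>s s) y) x = 0)"

definition entropy :: "spatial_domain \<Rightarrow> (real^3 \<Rightarrow> real) \<Rightarrow> real" where
  "entropy V \<rho> = (LINT x:cell V|lborel. \<rho> x * ln (\<rho> x))"

text \<open>For an ordinary domain, ``sufficiently rapid decay'' means precisely that the entropy may be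
  differentiated under the integral sign at \<open>s = 0\<close> and that the boundary term vanishes, all
  integrals being absolutely convergent. For the periodic box only periodicity is required.\<close>

primrec boundary_conditions ::
  "spatial_domain \<Rightarrow> real set \<Rightarrow> (real \<Rightarrow> real^3 \<Rightarrow> real) \<Rightarrow> (real \<Rightarrow> real^3 \<Rightarrow> real) \<Rightarrow> bool" where
  "boundary_conditions (Periodic_Box a b) J \<rho>s \<phi>s \<longleftrightarrow>
     (\<forall>s\<in>J. box_periodic a b (\<rho>s s) \<and> box_periodic a b (\<phi>s s))"
| "boundary_conditions (Domain V) J \<rho>s \<phi>s \<longleftrightarrow>
     (\<forall>s\<in>J. set_integrable lborel V (\<lambda>x. \<rho>s s x * ln (\<rho>s s x))) \<and>
     set_integrable lborel V (\<lambda>x. (1 + ln (\<rho>s 0 x)) * deriv (\<lambda>s. \<rho>s s x) 0) \<and>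
     set_integrable lborel V
       (divergence (\<lambda>y. ((1 + ln (\<rho>s 0 y)) * \<rho>s 0 y) *\<^sub>R grad (\<phi>s 0) y)) \<and>
     set_integrable lborel V
       (\<lambda>x. \<rho>s 0 x * (grad (\<lambda>y. ln (\<rho>s 0 y)) x \<bullet> grad (\<phi>s 0) x)) \<and>
     ((\<lambda>s. LINT x:V|lborel. \<rho>s s x * ln (\<rho>s s x)) has_real_derivative
        (LINT x:V|lborel. (1 + ln (\<rho>s 0 x)) * deriv (\<lambda>s. \<rho>s s x) 0)) (at 0) \<and>
     (LINT x:V|lborel. divergence (\<lambda>y. ((1 + ln (\<rho>s 0 y)) * \<rho>s 0 y) *\<^sub>R grad (\<phi>s 0) y) x) = 0"

text \<open>The potential \<open>\<psi>\<close> represents the Wasserstein gradient of the functional \<open>E\<close> at \<open>\<rho>\<close>, with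
  respect to the displacements through \<open>\<rho>\<close> obeying the boundary conditions above.\<close>

definition represents_wasserstein_gradient ::
  "spatial_domain \<Rightarrow> ((real^3 \<Rightarrow> real) \<Rightarrow> real) \<Rightarrow> (real^3 \<Rightarrow> real) \<Rightarrow> (real^3 \<Rightarrow> real) \<Rightarrow> bool" where
  "represents_wasserstein_gradient V E \<rho> \<psi> \<longleftrightarrow>
     (\<forall>J \<rho>s \<phi>s.
        displacement V J \<rho>s \<phi>s \<longrightarrow> boundary_conditions V J \<rho>s \<phi>s \<longrightarrow>
        (\<forall>x\<in>region V. \<rho>s 0 x = \<rho> x) \<longrightarrow>
          set_integrable lborel (cell V) (\<lambda>x. \<rho> x * (grad \<psi> x \<bullet> grad (\<phi>s 0) x)) \<and>
          ((\<lambda>s. E (\<rho>s s)) has_real_derivative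
             (LINT x:cell V|lborel. \<rho> x * (grad \<psi> x \<bullet> grad (\<phi>s 0) x))) (at 0))"


section \<open>The entropy force\<close>

definition entropy_force :: "(real^3 \<Rightarrow> real) \<Rightarrow> 3 \<Rightarrow> real^3 \<Rightarrow> real" where
  "entropy_force \<rho> i x = - partial_deriv i (\<lambda>y. ln (\<rho> y)) x"

definition entropy_hessian :: "(real^3 \<Rightarrow> real) \<Rightarrow> 3 \<Rightarrow> 3 \<Rightarrow> real^3 \<Rightarrow> real" where
  "entropy_hessian \<rho> i j x = - partial_deriv i (partial_deriv j (\<lambda>y. ln (\<rho> y))) x"

end

theory Submission
  imports Defs
begin

text \<open>By the continuity equation and the product rule, pointwise
  \<open>(1 + ln \<rho>) \<partial>\<^sub>s\<rho> = - (1 + ln \<rho>) \<nabla>\<cdot>(\<rho>\<nabla>\<phi>) = \<rho> \<nabla>(ln \<rho>)\<cdot>\<nabla>\<phi> - \<nabla>\<cdot>((1 + ln \<rho>) \<rho>\<nabla>\<phi>)\<close>. On an ordinary domain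
  the boundary conditions let one integrate this directly. On the periodic box, differentiation
  under the integral sign is justified by compactness of the box, and the divergence term
  integrates to zero: the integral of a periodic function over the box does not change when the
  function is translated along an axis, so its derivative in the translation parameter, which is the
  integral of a partial derivative, vanishes. The identity for the entropy force is the symmetry of
  the second partial derivatives of \<open>\<rho>\<close>.\<close>

section \<open>Smooth functions and their partial derivatives\<close>

text \<open>On an open set, functions that agree there have the same Frechet derivative at each of
  its points. The induction generalises over \<open>f\<close> and \<open>g\<close> because the step
  passes to their directional derivatives.\<close>

lemma Ck_on_cong:
  assumes "open S" "\<And>x. x \<in> S \<Longrightarrow> f x = g x" "Ck_on n S f"
  shows "Ck_on n S g"
  using assms(2,3)
proof (induction n arbitrary: f g)
  case 0
  then show ?case
    using continuous_on_cong[of S S f g] by simp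
next
  case (Suc n)
  have D: "(g has_derivative frechet_derivative f (at x)) (at x)" if "x \<in> S" for x
  proof (rule has_derivative_transform_within_open[OF _ \<open>open S\<close> that Suc.prems(1)])
    show "(f has_derivative frechet_derivative f (at x)) (at x)"
      using Suc.prems(2) that by (simp add: frechet_derivative_works[symmetric])
  qed
  then have "frechet_derivative f (at x) v = frechet_derivative g (at x) v" if "x \<in> S" for x v
    using frechet_derivative_at[OF D[OF that]] by simp
  then have "Ck_on n S (\<lambda>x. frechet_derivative g (at x) v)" for v
    using Suc.IH[of "\<lambda>x. frechet_derivative f (at x) v"] Suc.prems(2) by simp
  with D show ?case
    unfolding Ck_on.simps differentiable_def by blast
qed

lemma smooth_on_cong:
  assumes "open S" "\<And>x. x \<in> S \<Longrightarrow> f x = g x" "smooth_on S f"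
  shows "smooth_on S g"
  using assms Ck_on_cong[of S f g] by (auto simp: smooth_on_def)

lemma smooth_on_has_derivative:
  assumes "smooth_on S f" "x \<in> S"
  shows "(f has_derivative frechet_derivative f (at x)) (at x)"
proof -
  have "Ck_on (Suc 0) S f"
    using assms(1) unfolding smooth_on_def by blast
  then show ?thesis
    using assms(2) by (simp add: frechet_derivative_works[symmetric])
qed

lemma smooth_on_imp_continuous_on: "smooth_on S f \<Longrightarrow> continuous_on S f"
  unfolding smooth_on_def by (metis Ck_on.simps(1))

lemma smooth_on_frechet_derivative:
  assumes "smooth_on S f"
  shows "smooth_on S (\<lambda>x. frechet_derivative f (at x) v)"
  using assms unfolding smooth_on_def by (metis Ck_on.simps(2))

text \<open>Chain rule along a line. This is the bridge from the Frechet derivatives in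
  \<open>Ck_on\<close> to the one-variable derivatives in \<open>partial_deriv\<close>; it supplies
  the existence that \<open>deriv\<close>, being total, does not express.\<close>

lemma smooth_on_directional_derivative:
  assumes "smooth_on S f" "x \<in> S"
  shows "((\<lambda>t. f (x + t *\<^sub>R v)) has_real_derivative frechet_derivative f (at x) v) (at 0)"
proof -
  let ?D = "frechet_derivative f (at x)"
  \<comment> \<open>The base point is written as the value of the line at parameter 0, the form that
    the chain rule expects.\<close>
  have D: "(f has_derivative ?D) (at (x + 0 *\<^sub>R v))"
    using smooth_on_has_derivative[OF assms] by simp
  have "((\<lambda>t. f (x + t *\<^sub>R v)) has_derivative (\<lambda>t. ?D (t *\<^sub>R v))) (at 0)"
    by (rule has_derivative_compose[where f = "\<lambda>t. x + t *\<^sub>R v", OF _ D])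
      (auto intro!: derivative_eq_intros)
  moreover have "(\<lambda>t. ?D (t *\<^sub>R v)) = (*) (?D v)"
    using has_derivative_linear[OF D] by (auto simp: linear_cmul)
  ultimately show ?thesis
    by (simp add: has_field_derivative_def)
qed

lemma partial_deriv_eqI:
  "((\<lambda>t. f (x + t *\<^sub>R axis i 1)) has_real_derivative D) (at 0) \<Longrightarrow> partial_deriv i f x = D"
  unfolding partial_deriv_def by (rule DERIV_imp_deriv)

lemma smooth_on_has_partial_deriv:
  assumes "smooth_on S f" "x \<in> S"
  shows "((\<lambda>t. f (x + t *\<^sub>R axis i 1)) has_real_derivative partial_deriv i f x) (at 0)"
  using smooth_on_directional_derivative[OF assms] partial_deriv_eqI by metis

lemma smooth_on_partial_deriv:
  assumes "smooth_on S f" "open S"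
  shows "smooth_on S (partial_deriv i f)"
  using smooth_on_frechet_derivative[OF assms(1), of "axis i 1"]
  by (rule smooth_on_cong[OF assms(2), rotated])
    (metis assms(1) smooth_on_directional_derivative partial_deriv_eqI)

section \<open>Locality of partial derivatives\<close>

lemma eventually_line_in_open:
  fixes x v :: "'a::real_normed_vector"
  assumes "open S" "x \<in> S"
  shows "\<forall>\<^sub>F t in nhds (0::real). x + t *\<^sub>R v \<in> S"
proof -
  have "((\<lambda>t::real. x + t *\<^sub>R v) \<longlongrightarrow> x + 0 *\<^sub>R v) (nhds 0)"
    by (intro tendsto_intros filterlim_ident)
  then show ?thesis
    using assms by (simp add: topological_tendstoD)
qed

text \<open>A derivative at 0 sees only small parameters, for which the line through
  \<open>x\<close> stays in the open set \<open>S\<close>.\<close>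

lemma partial_deriv_cong:
  assumes "open S" "x \<in> S" "\<And>y. y \<in> S \<Longrightarrow> f y = g y"
  shows "partial_deriv i f x = partial_deriv i g x"
  unfolding partial_deriv_def
  by (intro deriv_cong_ev refl eventually_mono[OF eventually_line_in_open[OF assms(1,2)]])
    (use assms(3) in auto)

lemma grad_cong:
  assumes "open S" "x \<in> S" "\<And>y. y \<in> S \<Longrightarrow> f y = g y"
  shows "grad f x = grad g x"
  unfolding grad_def using partial_deriv_cong[OF assms] by simp

lemma has_partial_deriv_ln:
  assumes "smooth_on S f" "x \<in> S" "0 < f x"
  shows "((\<lambda>t. ln (f (x + t *\<^sub>R axis i 1))) has_real_derivative partial_deriv i f x / f x) (at 0)"
  using smooth_on_has_partial_deriv[OF assms(1,2)] assms(3)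
  by (auto intro!: derivative_eq_intros)


section \<open>Symmetry of second derivatives\<close>

text \<open>The mean value theorem is applied twice: along \<open>u\<close> to the increment of
  \<open>f\<close> in direction \<open>v\<close>, then along \<open>v\<close> to
  \<open>f\<^sub>u\<close>. Each application contributes one factor \<open>h\<close>.\<close>

lemma second_difference_mean_value:
  fixes f f\<^sub>u f\<^sub>u\<^sub>v :: "'a::real_normed_vector \<Rightarrow> real"
  assumes h: "0 < h"
    and S: "\<And>s t. s \<in> {0..h} \<Longrightarrow> t \<in> {0..h} \<Longrightarrow> x + s *\<^sub>R u + t *\<^sub>R v \<in> S"
    and f: "\<And>y. y \<in> S \<Longrightarrow> ((\<lambda>t. f (y + t *\<^sub>R u)) has_real_derivative f\<^sub>u y) (at 0)"
    and f\<^sub>u: "\<And>y. y \<in> S \<Longrightarrow> ((\<lambda>t. f\<^sub>u (y + t *\<^sub>R v)) has_real_derivative f\<^sub>u\<^sub>v y) (at 0)"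
  shows "\<exists>s\<in>{0..h}. \<exists>t\<in>{0..h}.
    f (x + h *\<^sub>R u + h *\<^sub>R v) - f (x + h *\<^sub>R u) - f (x + h *\<^sub>R v) + f x
      = h * h * f\<^sub>u\<^sub>v (x + s *\<^sub>R u + t *\<^sub>R v)"
proof -
  \<comment> \<open>The hypotheses give derivatives at parameter 0 from every base point in
    \<open>S\<close>; shifting the parameter gives derivatives all along the segments.\<close>
  have du: "((\<lambda>s. f (x + s *\<^sub>R u + t *\<^sub>R v)) has_real_derivative f\<^sub>u (x + s *\<^sub>R u + t *\<^sub>R v)) (at s)"
    if "s \<in> {0..h}" "t \<in> {0..h}" for s t
    using f[OF S[OF that]]
      DERIV_shift[of "\<lambda>s. f (x + s *\<^sub>R u + t *\<^sub>R v)" "f\<^sub>u (x + s *\<^sub>R u + t *\<^sub>R v)" 0 s]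
    by (simp add: algebra_simps)
  have dv: "((\<lambda>t. f\<^sub>u (x + s *\<^sub>R u + t *\<^sub>R v)) has_real_derivative f\<^sub>u\<^sub>v (x + s *\<^sub>R u + t *\<^sub>R v)) (at t)"
    if "s \<in> {0..h}" "t \<in> {0..h}" for s t
    using f\<^sub>u[OF S[OF that]]
      DERIV_shift[of "\<lambda>t. f\<^sub>u (x + s *\<^sub>R u + t *\<^sub>R v)" "f\<^sub>u\<^sub>v (x + s *\<^sub>R u + t *\<^sub>R v)" 0 t]
    by (simp add: algebra_simps)
  \<comment> \<open>The term \<open>0 *\<^sub>R v\<close> is kept so that both summands are
    instances of \<open>du\<close>, and so that the increment of \<open>f\<^sub>u\<close> runs
    between the endpoints 0 and \<open>h\<close> of \<open>dv\<close>.\<close>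
  define G where "G s = f (x + s *\<^sub>R u + h *\<^sub>R v) - f (x + s *\<^sub>R u + 0 *\<^sub>R v)" for s
  have "(G has_real_derivative
      f\<^sub>u (x + s *\<^sub>R u + h *\<^sub>R v) - f\<^sub>u (x + s *\<^sub>R u + 0 *\<^sub>R v)) (at s)"
    if "s \<in> {0..h}" for s
    unfolding G_def using h that by (intro DERIV_diff du) auto
  then obtain s where s: "0 < s" "s < h"
    "G h - G 0 = (h - 0) * (f\<^sub>u (x + s *\<^sub>R u + h *\<^sub>R v) - f\<^sub>u (x + s *\<^sub>R u + 0 *\<^sub>R v))"
    using MVT2[OF h, of G "\<lambda>s. f\<^sub>u (x + s *\<^sub>R u + h *\<^sub>R v) - f\<^sub>u (x + s *\<^sub>R u + 0 *\<^sub>R v)"]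
    by auto
  obtain t where t: "0 < t" "t < h"
    "f\<^sub>u (x + s *\<^sub>R u + h *\<^sub>R v) - f\<^sub>u (x + s *\<^sub>R u + 0 *\<^sub>R v)
      = (h - 0) * f\<^sub>u\<^sub>v (x + s *\<^sub>R u + t *\<^sub>R v)"
    using MVT2[OF h, of "\<lambda>t. f\<^sub>u (x + s *\<^sub>R u + t *\<^sub>R v)" "\<lambda>t. f\<^sub>u\<^sub>v (x + s *\<^sub>R u + t *\<^sub>R v)"]
      dv[of s] s(1,2) by auto
  have "f (x + h *\<^sub>R u + h *\<^sub>R v) - f (x + h *\<^sub>R u) - f (x + h *\<^sub>R v) + f x
      = h * h * f\<^sub>u\<^sub>v (x + s *\<^sub>R u + t *\<^sub>R v)"
    using s(3) unfolding t(3) by (simp add: G_def)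
  then show ?thesis
    using s(1,2) t(1,2) by (meson atLeastAtMost_iff less_imp_le)
qed

text \<open>Schwarz's theorem. The second difference over a parallelogram is symmetric in
  \<open>u\<close> and \<open>v\<close>, so a value of \<open>f\<^sub>u\<^sub>v\<close> and a value
  of \<open>f\<^sub>v\<^sub>u\<close> at points near \<open>x\<close> coincide; continuity carries
  the equality to \<open>x\<close>.\<close>

lemma directional_derivatives_commute:
  fixes f f\<^sub>u f\<^sub>v f\<^sub>u\<^sub>v f\<^sub>v\<^sub>u :: "'a::real_normed_vector \<Rightarrow> real"
  assumes "open S" "x \<in> S"
    and f\<^sub>u: "\<And>y. y \<in> S \<Longrightarrow> ((\<lambda>t. f (y + t *\<^sub>R u)) has_real_derivative f\<^sub>u y) (at 0)"
    and f\<^sub>v: "\<And>y. y \<in> S \<Longrightarrow> ((\<lambda>t. f (y + t *\<^sub>R v)) has_real_derivative f\<^sub>v y) (at 0)"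
    and f\<^sub>u\<^sub>v: "\<And>y. y \<in> S \<Longrightarrow> ((\<lambda>t. f\<^sub>u (y + t *\<^sub>R v)) has_real_derivative f\<^sub>u\<^sub>v y) (at 0)"
    and f\<^sub>v\<^sub>u: "\<And>y. y \<in> S \<Longrightarrow> ((\<lambda>t. f\<^sub>v (y + t *\<^sub>R u)) has_real_derivative f\<^sub>v\<^sub>u y) (at 0)"
    and "continuous_on S f\<^sub>u\<^sub>v" "continuous_on S f\<^sub>v\<^sub>u"
  shows "f\<^sub>u\<^sub>v x = f\<^sub>v\<^sub>u x"
proof (rule ccontr)
  assume "f\<^sub>u\<^sub>v x \<noteq> f\<^sub>v\<^sub>u x"
  \<comment> \<open>Half the supposed gap: a common value within \<open>e\<close> of both numbers
    would make their distance less than itself.\<close>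
  define e where "e = dist (f\<^sub>u\<^sub>v x) (f\<^sub>v\<^sub>u x) / 2"
  have "0 < e"
    using \<open>f\<^sub>u\<^sub>v x \<noteq> f\<^sub>v\<^sub>u x\<close> by (simp add: e_def)
  have "isCont f\<^sub>u\<^sub>v x" "isCont f\<^sub>v\<^sub>u x"
    using assms by (auto simp: continuous_on_eq_continuous_at)
  then have "\<forall>\<^sub>F y in nhds x. dist (f\<^sub>u\<^sub>v y) (f\<^sub>u\<^sub>v x) < e" "\<forall>\<^sub>F y in nhds x. dist (f\<^sub>v\<^sub>u y) (f\<^sub>v\<^sub>u x) < e"
    using \<open>0 < e\<close> by (auto simp: isCont_def tendsto_at_iff_tendsto_nhds intro: tendstoD)
  moreover have "\<forall>\<^sub>F y in nhds x. y \<in> S"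
    using assms(1,2) by (rule eventually_nhds_in_open)
  ultimately have "\<forall>\<^sub>F y in nhds x.
      y \<in> S \<and> dist (f\<^sub>u\<^sub>v y) (f\<^sub>u\<^sub>v x) < e \<and> dist (f\<^sub>v\<^sub>u y) (f\<^sub>v\<^sub>u x) < e"
    by eventually_elim auto
  then obtain d where d: "0 < d" "\<And>y. dist y x < d \<Longrightarrow>
      y \<in> S \<and> dist (f\<^sub>u\<^sub>v y) (f\<^sub>u\<^sub>v x) < e \<and> dist (f\<^sub>v\<^sub>u y) (f\<^sub>v\<^sub>u x) < e"
    by (auto simp: eventually_nhds_metric)
  \<comment> \<open>The parallelogram with sides \<open>h *\<^sub>R u\<close> and
    \<open>h *\<^sub>R v\<close> then lies in the ball of radius \<open>d\<close>. The summand 1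
    keeps the denominator positive when \<open>u\<close> and \<open>v\<close> vanish and makes the
    estimate strict.\<close>
  define h where "h = d / (norm u + norm v + 1)"
  have h: "0 < h"
    using d(1) by (auto simp: h_def intro!: divide_pos_pos add_nonneg_pos)
  have near: "dist (x + s *\<^sub>R u + t *\<^sub>R v) x < d" if "s \<in> {0..h}" "t \<in> {0..h}" for s t
  proof -
    have "dist (x + s *\<^sub>R u + t *\<^sub>R v) x \<le> norm (s *\<^sub>R u) + norm (t *\<^sub>R v)"
      using norm_triangle_ineq[of "s *\<^sub>R u" "t *\<^sub>R v"] by (simp add: dist_norm)
    also have "\<dots> \<le> h * norm u + h * norm v"
      using that by (auto intro!: add_mono mult_right_mono)
    also have "\<dots> < h * (norm u + norm v + 1)"
      using h by (simp add: algebra_simps)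
    also have "\<dots> = d"
      using norm_ge_zero[of u] norm_ge_zero[of v] by (simp add: h_def add_nonneg_eq_0_iff)
    finally show ?thesis .
  qed
  have swap: "x + s *\<^sub>R v + t *\<^sub>R u = x + t *\<^sub>R u + s *\<^sub>R v" for s t
    by (simp add: algebra_simps)
  obtain s t where st: "s \<in> {0..h}" "t \<in> {0..h}"
    "f (x + h *\<^sub>R u + h *\<^sub>R v) - f (x + h *\<^sub>R u) - f (x + h *\<^sub>R v) + f x
      = h * h * f\<^sub>u\<^sub>v (x + s *\<^sub>R u + t *\<^sub>R v)"
    using second_difference_mean_value[OF h, of x u v S f f\<^sub>u f\<^sub>u\<^sub>v] d(2)[OF near] f\<^sub>u f\<^sub>u\<^sub>v by metis
  have "x + s *\<^sub>R v + t *\<^sub>R u \<in> S" if "s \<in> {0..h}" "t \<in> {0..h}" for s t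
    using d(2)[OF near[OF that(2,1)]] unfolding swap by blast
  then obtain s' t' where st': "s' \<in> {0..h}" "t' \<in> {0..h}"
    "f (x + h *\<^sub>R v + h *\<^sub>R u) - f (x + h *\<^sub>R v) - f (x + h *\<^sub>R u) + f x
      = h * h * f\<^sub>v\<^sub>u (x + s' *\<^sub>R v + t' *\<^sub>R u)"
    using second_difference_mean_value[OF h, of x v u S f f\<^sub>v f\<^sub>v\<^sub>u] f\<^sub>v f\<^sub>v\<^sub>u by metis
  have "h * h * f\<^sub>u\<^sub>v (x + s *\<^sub>R u + t *\<^sub>R v) = h * h * f\<^sub>v\<^sub>u (x + t' *\<^sub>R u + s' *\<^sub>R v)"
    using st(3) st'(3) unfolding swap by linarith
  then have "f\<^sub>u\<^sub>v (x + s *\<^sub>R u + t *\<^sub>R v) = f\<^sub>v\<^sub>u (x + t' *\<^sub>R u + s' *\<^sub>R v)"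
    using h by simp
  moreover have "dist (f\<^sub>u\<^sub>v (x + s *\<^sub>R u + t *\<^sub>R v)) (f\<^sub>u\<^sub>v x) < e"
    using d(2)[OF near[OF st(1,2)]] by blast
  moreover have "dist (f\<^sub>v\<^sub>u (x + t' *\<^sub>R u + s' *\<^sub>R v)) (f\<^sub>v\<^sub>u x) < e"
    using d(2)[OF near[OF st'(2,1)]] by blast
  ultimately show False
    using dist_triangle_half_l[of "f\<^sub>u\<^sub>v x" _ "dist (f\<^sub>u\<^sub>v x) (f\<^sub>v\<^sub>u x)" "f\<^sub>v\<^sub>u x"]
    unfolding e_def by (metis dist_commute less_irrefl)
qed

lemma partial_derivs_commute:
  assumes "smooth_on S f" "open S" "x \<in> S"
  shows "partial_deriv i (partial_deriv j f) x = partial_deriv j (partial_deriv i f) x"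
  by (rule directional_derivatives_commute[OF assms(2,3)])
    (use assms(1,2) in \<open>auto intro!: smooth_on_has_partial_deriv[of S] smooth_on_partial_deriv
      smooth_on_imp_continuous_on\<close>)

section \<open>Second derivatives of the logarithm and the entropy force\<close>

lemma has_partial_deriv_partial_deriv_ln:
  assumes "smooth_on S f" "open S" "x \<in> S" "\<And>y. y \<in> S \<Longrightarrow> 0 < f y"
  shows "((\<lambda>t. partial_deriv i (\<lambda>y. ln (f y)) (x + t *\<^sub>R axis j 1)) has_real_derivative
    partial_deriv j (partial_deriv i f) x / f x - partial_deriv i f x * partial_deriv j f x / (f x)\<^sup>2)
    (at 0)"
proof -
  have "((\<lambda>t. partial_deriv i f (x + t *\<^sub>R axis j 1) / f (x + t *\<^sub>R axis j 1)) has_real_derivative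
    partial_deriv j (partial_deriv i f) x / f x - partial_deriv i f x * partial_deriv j f x / (f x)\<^sup>2)
    (at 0)"
    using smooth_on_has_partial_deriv[OF smooth_on_partial_deriv[OF assms(1,2)] assms(3), of i j]
      smooth_on_has_partial_deriv[OF assms(1,3), of j] assms(4)[OF assms(3)]
    by (auto intro!: derivative_eq_intros simp: field_simps power2_eq_square)
  \<comment> \<open>The quotient is the derivative of the logarithm only on \<open>S\<close>, where
    \<open>f\<close> is smooth and positive, so the two are identified for small
    \<open>t\<close>.\<close>
  moreover have "\<forall>\<^sub>F t in nhds 0. partial_deriv i f (x + t *\<^sub>R axis j 1) / f (x + t *\<^sub>R axis j 1)
      = partial_deriv i (\<lambda>y. ln (f y)) (x + t *\<^sub>R axis j 1)"
    using eventually_line_in_open[OF assms(2,3), of "axis j 1"]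
    by eventually_elim
      (simp add: partial_deriv_eqI[OF has_partial_deriv_ln[OF assms(1)]] assms(4))
  ultimately show ?thesis
    using DERIV_cong_ev[OF refl _ refl] by fast
qed

text \<open>Both sides are expanded in derivatives of \<open>\<rho>\<close>. The quadratic term is
  visibly symmetric in \<open>i\<close> and \<open>j\<close>, and Schwarz's theorem is applied to
  \<open>\<rho>\<close> itself, so smoothness of its logarithm need not be derived.\<close>

lemma partial_deriv_entropy_force:
  assumes "smooth_on S \<rho>" "open S" "x \<in> S" "\<And>y. y \<in> S \<Longrightarrow> 0 < \<rho> y"
  shows "partial_deriv j (entropy_force \<rho> i) x = entropy_hessian \<rho> i j x"
proof -
  have "partial_deriv j (entropy_force \<rho> i) x
      = - (partial_deriv j (partial_deriv i \<rho>) x / \<rho> x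
            - partial_deriv i \<rho> x * partial_deriv j \<rho> x / (\<rho> x)\<^sup>2)"
    unfolding entropy_force_def [abs_def]
    by (intro partial_deriv_eqI DERIV_minus has_partial_deriv_partial_deriv_ln[OF assms])
  then show ?thesis
    using partial_derivs_commute[OF assms(1-3), of i j]
    by (simp add: entropy_hessian_def partial_deriv_eqI[OF has_partial_deriv_partial_deriv_ln[OF assms]]
        mult.commute)
qed


section \<open>The divergence of the entropy flux\<close>

lemma has_partial_deriv_flux:
  assumes "smooth_on S \<rho>" "smooth_on S \<phi>" "open S" "x \<in> S"
  shows "((\<lambda>t. \<rho> (x + t *\<^sub>R axis i 1) * partial_deriv i \<phi> (x + t *\<^sub>R axis i 1)) has_real_derivative
    partial_deriv i \<rho> x * partial_deriv i \<phi> x + \<rho> x * partial_deriv i (partial_deriv i \<phi>) x) (at 0)"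
  using smooth_on_has_partial_deriv[OF assms(1,4), of i]
    smooth_on_has_partial_deriv[OF smooth_on_partial_deriv[OF assms(2,3)] assms(4), of i i]
  by (auto intro!: derivative_eq_intros)

text \<open>Product rule with the factors \<open>1 + ln \<rho>\<close> and
  \<open>\<rho> * partial_deriv i \<phi>\<close>. In the first summand the denominator from the
  derivative of the logarithm has cancelled against \<open>\<rho>\<close>.\<close>

lemma has_partial_deriv_entropy_flux:
  assumes "smooth_on S \<rho>" "smooth_on S \<phi>" "open S" "x \<in> S" "0 < \<rho> x"
  shows "((\<lambda>t. (1 + ln (\<rho> (x + t *\<^sub>R axis i 1))) * \<rho> (x + t *\<^sub>R axis i 1)
        * partial_deriv i \<phi> (x + t *\<^sub>R axis i 1)) has_real_derivative
    partial_deriv i \<rho> x * partial_deriv i \<phi> x + (1 + ln (\<rho> x)) *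
      (partial_deriv i \<rho> x * partial_deriv i \<phi> x + \<rho> x * partial_deriv i (partial_deriv i \<phi>) x)) (at 0)"
  unfolding mult.assoc
  using DERIV_mult[OF DERIV_add[OF DERIV_const has_partial_deriv_ln[OF assms(1,4,5)]]
      has_partial_deriv_flux[OF assms(1-4)], of 1 i i] assms(5)
  by (simp add: field_simps)

text \<open>Sum of the preceding componentwise formula over \<open>i\<close>. The second divergence
  on the right is the one in the continuity equation.\<close>

lemma divergence_entropy_flux:
  assumes "smooth_on S \<rho>" "smooth_on S \<phi>" "open S" "x \<in> S" "0 < \<rho> x"
  shows "divergence (\<lambda>y. ((1 + ln (\<rho> y)) * \<rho> y) *\<^sub>R grad \<phi> y) x
    = \<rho> x * (grad (\<lambda>y. ln (\<rho> y)) x \<bullet> grad \<phi> x)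
      + (1 + ln (\<rho> x)) * divergence (\<lambda>y. \<rho> y *\<^sub>R grad \<phi> y) x"
  using assms(5)
  by (simp add: divergence_def grad_def inner_vec_def sum_distrib_left sum.distrib distrib_left
      partial_deriv_eqI[OF has_partial_deriv_ln[OF assms(1,4,5)]]
      partial_deriv_eqI[OF has_partial_deriv_flux[OF assms(1-4)]]
      partial_deriv_eqI[OF has_partial_deriv_entropy_flux[OF assms]])


section \<open>Integrals of periodic functions\<close>

text \<open>Shifts by at most one period in the positive direction suffice later, where a one-sided
  derivative at shift 0 is taken.\<close>

lemma integral_periodic_shift:
  fixes f :: "real^3 \<Rightarrow> real"
  assumes f: "continuous_on UNIV f" and per: "box_periodic a b f"
    and t: "0 \<le> t" "t \<le> b $ i - a $ i"
  shows "integral (cbox a b) (\<lambda>x. f (x + t *\<^sub>R axis i 1)) = integral (cbox a b) f"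
proof -
  let ?e = "axis i (1::real) :: real^3"
  define L where "L = b $ i - a $ i"
  have int: "f integrable_on cbox c d" for c d
    by (rule integrable_continuous[OF continuous_on_subset[OF f]]) simp
  have e: "?e \<in> Basis"
    by (simp add: axis_in_Basis_iff)
  have box: "x \<in> cbox (a + p *\<^sub>R ?e) (b + q *\<^sub>R ?e) \<longleftrightarrow> a $ i + p \<le> x $ i \<and> x $ i \<le> b $ i + q \<and>
      (\<forall>j. j \<noteq> i \<longrightarrow> a $ j \<le> x $ j \<and> x $ j \<le> b $ j)" for x p q
    by (auto simp: mem_box_cart axis_def)
  \<comment> \<open>Copies with a zero shift are added because such corners occur as plain
    \<open>a\<close> and \<open>b\<close>.\<close>
  note box = box box[of _ 0, simplified] box[of _ _ 0, simplified] box[of _ 0 0, simplified]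
  have perL: "f (x + L *\<^sub>R ?e) = f x" for x
  proof -
    have "L *\<^sub>R ?e = axis i L"
      by (simp add: axis_def vec_eq_iff)
    with per show ?thesis
      by (simp add: box_periodic_def L_def)
  qed
  text \<open>The part of the translated box that sticks out at the top is a translate, by a full period,
    of the part that is missing at the bottom.\<close>
  have "integral (cbox a b) (\<lambda>x. f (x + t *\<^sub>R ?e)) = integral (cbox (a + t *\<^sub>R ?e) (b + t *\<^sub>R ?e)) f"
    using integral_shift_cbox[of "a + t *\<^sub>R ?e" "t *\<^sub>R ?e" "b + t *\<^sub>R ?e" f] by simp
  also have "\<dots> = integral (cbox (a + t *\<^sub>R ?e) (b + t *\<^sub>R ?e) \<inter> {x. x \<bullet> ?e \<le> b $ i}) f
      + integral (cbox (a + t *\<^sub>R ?e) (b + t *\<^sub>R ?e) \<inter> {x. b $ i \<le> x \<bullet> ?e}) f"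
    by (rule integral_split[OF int e])
  also have "cbox (a + t *\<^sub>R ?e) (b + t *\<^sub>R ?e) \<inter> {x. x \<bullet> ?e \<le> b $ i} = cbox (a + t *\<^sub>R ?e) b"
    using t by (auto simp: box inner_axis)
  also have "cbox (a + t *\<^sub>R ?e) (b + t *\<^sub>R ?e) \<inter> {x. b $ i \<le> x \<bullet> ?e}
      = cbox (a + L *\<^sub>R ?e) (b + t *\<^sub>R ?e)"
    using t by (auto simp: box inner_axis L_def)
  also have "integral (cbox (a + L *\<^sub>R ?e) (b + t *\<^sub>R ?e)) f
      = integral (cbox a (b + (t - L) *\<^sub>R ?e)) (\<lambda>x. f (x + L *\<^sub>R ?e))"
    using integral_shift_cbox[of "a + L *\<^sub>R ?e" "L *\<^sub>R ?e" "b + t *\<^sub>R ?e" f]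
    by (simp add: algebra_simps)
  also have "\<dots> = integral (cbox a (b + (t - L) *\<^sub>R ?e)) f"
    by (simp add: perL)
  \<comment> \<open>Since \<open>b $ i + (t - L)\<close> equals \<open>a $ i + t\<close>, the two
    pieces are now the lower and upper parts of the original box, cut at that height.\<close>
  also have "cbox a (b + (t - L) *\<^sub>R ?e) = cbox a b \<inter> {x. x \<bullet> ?e \<le> a $ i + t}"
    using t by (auto simp: box inner_axis L_def)
  also have "cbox (a + t *\<^sub>R ?e) b = cbox a b \<inter> {x. a $ i + t \<le> x \<bullet> ?e}"
    using t by (auto simp: box inner_axis L_def)
  also have "integral (cbox a b \<inter> {x. a $ i + t \<le> x \<bullet> ?e}) f
      + integral (cbox a b \<inter> {x. x \<bullet> ?e \<le> a $ i + t}) f = integral (cbox a b) f"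
    using integral_split[OF int e, of a b "a $ i + t"] by simp
  finally show ?thesis .
qed

lemma integral_partial_deriv_periodic:
  fixes f f' :: "real^3 \<Rightarrow> real"
  assumes f: "continuous_on UNIV f" and f': "continuous_on UNIV f'"
    and per: "box_periodic a b f" and ab: "\<And>j. a $ j < b $ j"
    and deriv: "\<And>x. ((\<lambda>t. f (x + t *\<^sub>R axis i 1)) has_real_derivative f' x) (at 0)"
  shows "integral (cbox a b) f' = 0"
proof -
  let ?e = "axis i (1::real) :: real^3"
  define L where "L = b $ i - a $ i"
  have L: "0 < L"
    using ab by (simp add: L_def)
  have der: "((\<lambda>t. f (x + t *\<^sub>R ?e)) has_real_derivative f' (x + t *\<^sub>R ?e)) (at t)" for x t
    using deriv[of "x + t *\<^sub>R ?e"] DERIV_shift[of "\<lambda>t. f (x + t *\<^sub>R ?e)" "f' (x + t *\<^sub>R ?e)" 0 t]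
    by (simp add: algebra_simps)
  have "((\<lambda>t. integral (cbox a b) (\<lambda>x. f (x + t *\<^sub>R ?e))) has_real_derivative
      integral (cbox a b) (\<lambda>x. f' (x + 0 *\<^sub>R ?e))) (at 0 within {0..L})"
  proof (rule leibniz_rule_field_derivative)
    show "((\<lambda>t. f (x + t *\<^sub>R ?e)) has_real_derivative f' (x + t *\<^sub>R ?e)) (at t within {0..L})" for x t
      using der by (rule DERIV_subset) simp
    show "(\<lambda>x. f (x + t *\<^sub>R ?e)) integrable_on cbox a b" for t
      by (intro integrable_continuous continuous_on_compose2[OF f] continuous_intros subset_UNIV)
    show "continuous_on ({0..L} \<times> cbox a b) (\<lambda>(t, x). f' (x + t *\<^sub>R ?e))"
      unfolding split_beta
      by (intro continuous_on_compose2[OF f'] continuous_intros subset_UNIV)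
  qed (use L in auto)
  then have 1: "((\<lambda>t. integral (cbox a b) (\<lambda>x. f (x + t *\<^sub>R ?e))) has_real_derivative
      integral (cbox a b) f') (at 0 within {0..L})"
    by simp
  \<comment> \<open>By periodicity the differentiated function is constant on \<open>{0..L}\<close>.
    Its derivative is therefore also 0, and uniqueness of derivatives within an interval of positive
    length concludes.\<close>
  have "((\<lambda>t. integral (cbox a b) f) has_real_derivative integral (cbox a b) f') (at 0 within {0..L})"
    by (rule has_field_derivative_transform_within[OF 1 zero_less_one])
      (use L ab in \<open>auto intro!: integral_periodic_shift[OF f per] less_imp_le simp: L_def\<close>)
  then have "((\<lambda>t. integral (cbox a b) f) has_vector_derivative integral (cbox a b) f')
      (at 0 within cbox 0 L)"
    by (simp add: has_real_derivative_iff_has_vector_derivative)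
  then show ?thesis
    by (rule vector_derivative_unique_within_closed_interval[OF L, rotated 1])
      (use L in auto)
qed

lemma box_periodic_partial_deriv:
  assumes "box_periodic a b f"
  shows "box_periodic a b (partial_deriv i f)"
proof -
  have "f (x + axis j (b $ j - a $ j) + v) = f (x + v)" for x v j
    using assms unfolding box_periodic_def by (metis add.assoc add.commute)
  then show ?thesis
    unfolding box_periodic_def partial_deriv_def by simp
qed

text \<open>Bridge from the Lebesgue integral of the definitions to the gauge integral, in which
  boxes are cut and the Leibniz rule is applied.\<close>

lemma set_integral_continuous_cbox:
  fixes f :: "'a::euclidean_space \<Rightarrow> real"
  assumes "continuous_on (cbox a b) f"
  shows "set_integrable lborel (cbox a b) f"
    and "(LINT x:cbox a b|lborel. f x) = integral (cbox a b) f"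
proof -
  show "set_integrable lborel (cbox a b) f"
    unfolding set_integrable_def by (rule borel_integrable_compact[OF compact_cbox assms])
  then show "(LINT x:cbox a b|lborel. f x) = integral (cbox a b) f"
    by (rule set_borel_integral_eq_integral)
qed

lemma integral_divergence_entropy_flux_periodic:
  assumes \<rho>: "smooth_on UNIV \<rho>" "\<And>x. 0 < \<rho> x" "box_periodic a b \<rho>"
    and \<phi>: "smooth_on UNIV \<phi>" "box_periodic a b \<phi>" and ab: "\<And>i. a $ i < b $ i"
  shows "continuous_on UNIV (divergence (\<lambda>y. ((1 + ln (\<rho> y)) * \<rho> y) *\<^sub>R grad \<phi> y))"
    and "integral (cbox a b) (divergence (\<lambda>y. ((1 + ln (\<rho> y)) * \<rho> y) *\<^sub>R grad \<phi> y)) = 0"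
proof -
  define F where "F i y = (1 + ln (\<rho> y)) * \<rho> y * partial_deriv i \<phi> y" for i y
  \<comment> \<open>The closed form of the \<open>i\<close>-th partial derivative of
    \<open>F i\<close>, from whose factors continuity can be read off.\<close>
  define F' where "F' i x = partial_deriv i \<rho> x * partial_deriv i \<phi> x + (1 + ln (\<rho> x)) *
      (partial_deriv i \<rho> x * partial_deriv i \<phi> x + \<rho> x * partial_deriv i (partial_deriv i \<phi>) x)" for i x
  have der: "((\<lambda>t. F i (x + t *\<^sub>R axis i 1)) has_real_derivative F' i x) (at 0)" for i x
    unfolding F_def F'_def by (rule has_partial_deriv_entropy_flux) (use \<rho> \<phi> in auto)
  have div: "divergence (\<lambda>y. ((1 + ln (\<rho> y)) * \<rho> y) *\<^sub>R grad \<phi> y) = (\<lambda>x. \<Sum>i\<in>UNIV. F' i x)"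
    using partial_deriv_eqI[OF der] by (simp add: fun_eq_iff divergence_def grad_def F_def)
  have "\<rho> x \<noteq> 0" for x
    using \<rho>(2)[of x] by simp
  moreover have "continuous_on UNIV \<rho>" "\<And>i. continuous_on UNIV (partial_deriv i \<rho>)"
    "\<And>i. continuous_on UNIV (partial_deriv i \<phi>)"
    "\<And>i. continuous_on UNIV (partial_deriv i (partial_deriv i \<phi>))"
    using \<rho>(1) \<phi>(1) by (auto intro!: smooth_on_imp_continuous_on smooth_on_partial_deriv)
  ultimately have cont: "continuous_on UNIV (F i)" "continuous_on UNIV (F' i)" for i
    unfolding F_def [abs_def] F'_def [abs_def] by (auto intro!: continuous_intros)
  show "continuous_on UNIV (divergence (\<lambda>y. ((1 + ln (\<rho> y)) * \<rho> y) *\<^sub>R grad \<phi> y))"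
    unfolding div by (intro continuous_intros cont)
  have "box_periodic a b (F i)" for i
    using \<rho>(3) box_periodic_partial_deriv[OF \<phi>(2)] by (simp add: box_periodic_def F_def)
  then have "integral (cbox a b) (F' i) = 0" for i
    using integral_partial_deriv_periodic[OF cont _ ab der] by blast
  moreover have "F' i integrable_on cbox a b" for i
    by (rule integrable_continuous[OF continuous_on_subset[OF cont(2)]]) simp
  ultimately show "integral (cbox a b) (divergence (\<lambda>y. ((1 + ln (\<rho> y)) * \<rho> y) *\<^sub>R grad \<phi> y)) = 0"
    unfolding div by (simp add: integral_sum)
qed


section \<open>The first variation of the entropy\<close>

lemma entropy_has_derivative_box:
  fixes \<rho>s :: "real \<Rightarrow> real^3 \<Rightarrow> real"
  assumes J: "open J" "0 \<in> J" and smooth: "smooth_on (J \<times> UNIV) (\<lambda>(s, x). \<rho>s s x)"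
    and pos: "\<And>s x. s \<in> J \<Longrightarrow> 0 < \<rho>s s x"
  shows "continuous_on UNIV (\<lambda>x. (1 + ln (\<rho>s 0 x)) * deriv (\<lambda>s. \<rho>s s x) 0)"
    and "((\<lambda>s. entropy (Periodic_Box a b) (\<rho>s s)) has_real_derivative
      integral (cbox a b) (\<lambda>x. (1 + ln (\<rho>s 0 x)) * deriv (\<lambda>s. \<rho>s s x) 0)) (at 0)"
proof -
  let ?\<rho> = "\<lambda>(s, x). \<rho>s s x"
  \<comment> \<open>The \<open>s\<close>-derivative is taken as the Frechet derivative of the joint
    function in direction \<open>(1, 0)\<close>; joint smoothness then makes it continuous in
    \<open>(s, x)\<close>, as the Leibniz rule requires.\<close>
  define D where "D p = frechet_derivative ?\<rho> (at p) (1, 0)" for p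
  have der: "((\<lambda>s. \<rho>s s x) has_real_derivative D (s, x)) (at s)" if "s \<in> J" for s x
    using smooth_on_directional_derivative[OF smooth, of "(s, x)" "(1, 0)"] that
      DERIV_shift[of "\<lambda>s. \<rho>s s x" "D (s, x)" 0 s]
    by (simp add: D_def add.commute)
  have nz: "\<rho>s s x \<noteq> 0" if "s \<in> J" for s x
    using pos[OF that, of x] by simp
  have c\<rho>: "continuous_on (J \<times> UNIV) (\<lambda>p. \<rho>s (fst p) (snd p))"
    using smooth_on_imp_continuous_on[OF smooth] by (simp add: split_beta)
  have cD: "continuous_on (J \<times> UNIV) D"
    unfolding D_def [abs_def]
    by (intro smooth_on_imp_continuous_on smooth_on_frechet_derivative smooth)
  have cont: "continuous_on (J \<times> UNIV) (\<lambda>p. (1 + ln (\<rho>s (fst p) (snd p))) * D p)"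
    by (intro continuous_intros c\<rho> cD) (use nz in auto)
  have D0: "deriv (\<lambda>s. \<rho>s s x) 0 = D (0, x)" for x
    using der[OF J(2)] by (rule DERIV_imp_deriv)
  have slice: "continuous_on X (\<lambda>x. (s, x))" for s :: real and X :: "(real^3) set"
    by (intro continuous_intros)
  show "continuous_on UNIV (\<lambda>x. (1 + ln (\<rho>s 0 x)) * deriv (\<lambda>s. \<rho>s s x) 0)"
    using continuous_on_compose2[OF cont slice[of UNIV 0]] J by (auto simp: D0)
  \<comment> \<open>A ball inside \<open>J\<close> gives a convex parameter set for the Leibniz
    rule; being open, it turns the derivative within \<open>U\<close> into a full one.\<close>
  obtain e where e: "0 < e" "ball 0 e \<subseteq> J"
    using J by (auto simp: open_contains_ball)
  define U where "U = ball (0::real) e"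
  have U: "open U" "convex U" "0 \<in> U" "U \<subseteq> J"
    using e by (auto simp: U_def)
  have cs: "continuous_on (cbox a b) (\<lambda>x. \<rho>s s x * ln (\<rho>s s x))" if "s \<in> J" for s
  proof -
    have "continuous_on (cbox a b) (\<rho>s s)"
      using continuous_on_compose2[OF c\<rho> slice[of "cbox a b" s]] that by auto
    then show ?thesis
      using nz[OF that] by (intro continuous_intros) auto
  qed
  have "((\<lambda>s. integral (cbox a b) (\<lambda>x. \<rho>s s x * ln (\<rho>s s x))) has_real_derivative
      integral (cbox a b) (\<lambda>x. (1 + ln (\<rho>s 0 x)) * D (0, x))) (at 0 within U)"
  proof (rule leibniz_rule_field_derivative[where fx = "\<lambda>s x. (1 + ln (\<rho>s s x)) * D (s, x)"])
    show "((\<lambda>s. \<rho>s s x * ln (\<rho>s s x)) has_real_derivative (1 + ln (\<rho>s s x)) * D (s, x))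
        (at s within U)" if "s \<in> U" for s x
    proof -
      have s: "s \<in> J"
        using that U by auto
      have "((\<lambda>s. \<rho>s s x * ln (\<rho>s s x)) has_real_derivative (1 + ln (\<rho>s s x)) * D (s, x)) (at s)"
        using DERIV_mult[OF der[OF s] DERIV_chain2[OF DERIV_ln[OF pos[OF s]] der[OF s]], of x x]
          nz[OF s, of x]
        by (simp add: field_simps)
      then show ?thesis
        by (rule DERIV_subset) simp
    qed
    show "(\<lambda>x. \<rho>s s x * ln (\<rho>s s x)) integrable_on cbox a b" if "s \<in> U" for s
      using that U by (intro integrable_continuous cs) auto
    show "continuous_on (U \<times> cbox a b) (\<lambda>(s, x). (1 + ln (\<rho>s s x)) * D (s, x))"
      using continuous_on_subset[OF cont, of "U \<times> cbox a b"] U by (auto simp: split_beta)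
  qed (use U in auto)
  then have "((\<lambda>s. integral (cbox a b) (\<lambda>x. \<rho>s s x * ln (\<rho>s s x))) has_real_derivative
      integral (cbox a b) (\<lambda>x. (1 + ln (\<rho>s 0 x)) * deriv (\<lambda>s. \<rho>s s x) 0)) (at 0)"
    unfolding D0 at_within_open[OF U(3,1)] .
  then show "((\<lambda>s. entropy (Periodic_Box a b) (\<rho>s s)) has_real_derivative
      integral (cbox a b) (\<lambda>x. (1 + ln (\<rho>s 0 x)) * deriv (\<lambda>s. \<rho>s s x) 0)) (at 0)"
    by (rule has_field_derivative_transform_within_open[OF _ U(1,3)])
      (use U cs in \<open>simp add: entropy_def set_integral_continuous_cbox(2) subset_iff\<close>)
qed

section \<open>Both kinds of spatial domain together\<close>

lemma open_region: "is_spatial_domain V \<Longrightarrow> open (region V)"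
  by (cases V) auto

lemma cell_subset_region: "cell V \<subseteq> region V"
  by (cases V) auto

lemma cell_borel: "is_spatial_domain V \<Longrightarrow> cell V \<in> sets lborel"
  by (cases V) auto

text \<open>By the continuity equation the integrand \<open>?G\<close> is the time-derivative term
  \<open>?T\<close> plus the divergence \<open>?D\<close>, whose integral vanishes. Integrability of
  \<open>?G\<close> is inherited from the two summands.\<close>

lemma entropy_first_variation:
  assumes V: "is_spatial_domain V" and disp: "displacement V J \<rho>s \<phi>s"
    and bc: "boundary_conditions V J \<rho>s \<phi>s"
  shows "set_integrable lborel (cell V) (\<lambda>x. \<rho>s 0 x * (grad (\<lambda>y. ln (\<rho>s 0 y)) x \<bullet> grad (\<phi>s 0) x))"
      (is "set_integrable _ _ ?G")
    and "((\<lambda>s. entropy V (\<rho>s s)) has_real_derivative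
      (LINT x:cell V|lborel. \<rho>s 0 x * (grad (\<lambda>y. ln (\<rho>s 0 y)) x \<bullet> grad (\<phi>s 0) x))) (at 0)"
proof -
  let ?D = "divergence (\<lambda>y. ((1 + ln (\<rho>s 0 y)) * \<rho>s 0 y) *\<^sub>R grad (\<phi>s 0) y)"
  let ?T = "\<lambda>x. (1 + ln (\<rho>s 0 x)) * deriv (\<lambda>s. \<rho>s s x) 0"
  note d = disp[unfolded displacement_def smooth_density_def]
  have J: "open J" "0 \<in> J" and \<rho>: "smooth_on (region V) (\<rho>s 0)" "\<And>x. x \<in> region V \<Longrightarrow> 0 < \<rho>s 0 x"
    and \<phi>: "smooth_on (region V) (\<phi>s 0)"
    using d by auto
  have GTD: "?G x = ?T x + ?D x" if "x \<in> cell V" for x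
  proof -
    have x: "x \<in> region V"
      using that cell_subset_region by auto
    have "deriv (\<lambda>t. \<rho>s t x) 0 = - divergence (\<lambda>y. \<rho>s 0 y *\<^sub>R grad (\<phi>s 0) y) x"
      using d x by (simp add: eq_neg_iff_add_eq_0)
    then show ?thesis
      using divergence_entropy_flux[OF \<rho>(1) \<phi> open_region[OF V] x \<rho>(2)[OF x]] by simp
  qed
  \<comment> \<open>The only place where the two kinds of domain are treated separately: for
    \<open>Domain\<close> these facts are among the boundary conditions, for
    \<open>Periodic_Box\<close> they follow from smoothness and periodicity.\<close>
  have TD: "set_integrable lborel (cell V) ?T \<and> set_integrable lborel (cell V) ?D \<and>
      (LINT x:cell V|lborel. ?D x) = 0 \<and>
      ((\<lambda>s. entropy V (\<rho>s s)) has_real_derivative (LINT x:cell V|lborel. ?T x)) (at 0)"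
  proof (cases V)
    case (Domain W)
    with bc show ?thesis
      by (simp add: entropy_def)
  next
    case (Periodic_Box a b)
    have per: "box_periodic a b (\<rho>s 0)" "box_periodic a b (\<phi>s 0)" and ab: "\<And>i. a $ i < b $ i"
      using bc V J Periodic_Box by auto
    have pos: "0 < \<rho>s s x" if "s \<in> J" for s x
      using d that Periodic_Box by auto
    have smooth: "smooth_on (J \<times> UNIV) (\<lambda>(s, x). \<rho>s s x)"
      using d Periodic_Box by auto
    note T = entropy_has_derivative_box[OF J smooth pos]
    note D = integral_divergence_entropy_flux_periodic[of "\<rho>s 0" a b "\<phi>s 0"]
    have cD: "continuous_on UNIV ?D" "integral (cbox a b) ?D = 0"
      using D \<rho> \<phi> per ab Periodic_Box by auto
    show ?thesis
      using T(2)[of a b] cD(2) set_integral_continuous_cbox[OF continuous_on_subset[OF T(1)], of a b]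
        set_integral_continuous_cbox[OF continuous_on_subset[OF cD(1)], of a b]
      by (simp add: Periodic_Box)
  qed
  then have T: "set_integrable lborel (cell V) ?T" and D: "set_integrable lborel (cell V) ?D"
    and D0: "(LINT x:cell V|lborel. ?D x) = 0"
    and E: "((\<lambda>s. entropy V (\<rho>s s)) has_real_derivative (LINT x:cell V|lborel. ?T x)) (at 0)"
    by blast+
  show "set_integrable lborel (cell V) ?G"
  proof (rule iffD2[OF set_integrable_cong set_integral_add(1)[OF T D]])
    show "?G x = ?T x + ?D x" if "x \<in> cell V" for x
      using that by (rule GTD)
  qed simp_all
  have "(LINT x:cell V|lborel. ?G x) = (LINT x:cell V|lborel. ?T x + ?D x)"
    using GTD by (intro set_lebesgue_integral_cong[OF cell_borel[OF V]]) blast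
  also have "\<dots> = (LINT x:cell V|lborel. ?T x)"
    unfolding set_integral_add(2)[OF T D] D0 by (rule add_0_right)
  finally show "((\<lambda>s. entropy V (\<rho>s s)) has_real_derivative (LINT x:cell V|lborel. ?G x)) (at 0)"
    using E by (simp only:)
qed

text \<open>A displacement through \<open>\<rho>\<close> starts at a function that agrees with
  \<open>\<rho>\<close> on \<open>region V\<close> only. That set is open, so the gradients of the
  logarithms agree there too, and the first variation formula carries over.\<close>

lemma ln_represents_wasserstein_gradient:
  assumes "is_spatial_domain V"
  shows "represents_wasserstein_gradient V (entropy V) \<rho> (\<lambda>x. ln (\<rho> x))"
  unfolding represents_wasserstein_gradient_def
proof (intro allI impI)
  fix J \<rho>s \<phi>s
  assume disp: "displacement V J \<rho>s \<phi>s" "boundary_conditions V J \<rho>s \<phi>s"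
    and eq: "\<forall>x\<in>region V. \<rho>s 0 x = \<rho> x"
  have cong: "\<rho>s 0 x * (grad (\<lambda>y. ln (\<rho>s 0 y)) x \<bullet> grad (\<phi>s 0) x)
      = \<rho> x * (grad (\<lambda>y. ln (\<rho> y)) x \<bullet> grad (\<phi>s 0) x)" if "x \<in> cell V" for x
  proof -
    have x: "x \<in> region V"
      using that cell_subset_region by auto
    show ?thesis
      using grad_cong[OF open_region[OF assms] x, of "\<lambda>y. ln (\<rho>s 0 y)" "\<lambda>y. ln (\<rho> y)"] eq x by simp
  qed
  have "(LINT x:cell V|lborel. \<rho>s 0 x * (grad (\<lambda>y. ln (\<rho>s 0 y)) x \<bullet> grad (\<phi>s 0) x))
      = (LINT x:cell V|lborel. \<rho> x * (grad (\<lambda>y. ln (\<rho> y)) x \<bullet> grad (\<phi>s 0) x))"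
    using cell_borel[OF assms] cong by (intro set_lebesgue_integral_cong) auto
  moreover have
    "set_integrable lborel (cell V) (\<lambda>x. \<rho>s 0 x * (grad (\<lambda>y. ln (\<rho>s 0 y)) x \<bullet> grad (\<phi>s 0) x))
      = set_integrable lborel (cell V) (\<lambda>x. \<rho> x * (grad (\<lambda>y. ln (\<rho> y)) x \<bullet> grad (\<phi>s 0) x))"
    by (rule set_integrable_cong) (simp_all add: cong)
  ultimately show "set_integrable lborel (cell V) (\<lambda>x. \<rho> x * (grad (\<lambda>x. ln (\<rho> x)) x \<bullet> grad (\<phi>s 0) x)) \<and>
      ((\<lambda>s. entropy V (\<rho>s s)) has_real_derivative
        (LINT x:cell V|lborel. \<rho> x * (grad (\<lambda>x. ln (\<rho> x)) x \<bullet> grad (\<phi>s 0) x))) (at 0)"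
    using entropy_first_variation[OF assms disp] by simp
qed

theorem proposition2p1:
  fixes V :: spatial_domain
    and \<rho> \<phi> :: "real^3 \<Rightarrow> real"
    and J :: "real set"
    and \<rho>s \<phi>s :: "real \<Rightarrow> real^3 \<Rightarrow> real"
  assumes "is_spatial_domain V"
    and "smooth_density V \<rho>"
    and "smooth_on (region V) \<phi>"
    and "displacement V J \<rho>s \<phi>s"
    and "\<forall>x\<in>region V. \<rho>s 0 x = \<rho> x"
    and "\<forall>x\<in>region V. \<phi>s 0 x = \<phi> x"
    and "boundary_conditions V J \<rho>s \<phi>s"
  shows "((\<lambda>s. entropy V (\<rho>s s)) has_real_derivative
            (LINT x:cell V|lborel. \<rho> x * (grad (\<lambda>y. ln (\<rho> y)) x \<bullet> grad \<phi> x))) (at 0)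
       \<and> represents_wasserstein_gradient V (entropy V) \<rho> (\<lambda>x. ln (\<rho> x))
       \<and> (\<forall>x\<in>cell V. \<forall>i j.
            partial_deriv j (entropy_force \<rho> i) x = entropy_hessian \<rho> i j x)"
proof (intro conjI ballI allI)
  \<comment> \<open>Proved first, since the first variation along the given curve is an instance of
    it, up to replacing \<open>\<phi>s 0\<close> by \<open>\<phi>\<close>.\<close>
  show grad: "represents_wasserstein_gradient V (entropy V) \<rho> (\<lambda>x. ln (\<rho> x))"
    using assms(1) by (rule ln_represents_wasserstein_gradient)
  have "grad (\<phi>s 0) x = grad \<phi> x" if "x \<in> cell V" for x
    using that cell_subset_region assms(6) by (intro grad_cong[OF open_region[OF assms(1)]]) auto
  then have "(LINT x:cell V|lborel. \<rho> x * (grad (\<lambda>y. ln (\<rho> y)) x \<bullet> grad (\<phi>s 0) x))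
      = (LINT x:cell V|lborel. \<rho> x * (grad (\<lambda>y. ln (\<rho> y)) x \<bullet> grad \<phi> x))"
    using cell_borel[OF assms(1)] by (intro set_lebesgue_integral_cong) auto
  moreover have "((\<lambda>s. entropy V (\<rho>s s)) has_real_derivative
      (LINT x:cell V|lborel. \<rho> x * (grad (\<lambda>y. ln (\<rho> y)) x \<bullet> grad (\<phi>s 0) x))) (at 0)"
    using grad assms(4,5,7) unfolding represents_wasserstein_gradient_def by blast
  ultimately show "((\<lambda>s. entropy V (\<rho>s s)) has_real_derivative
      (LINT x:cell V|lborel. \<rho> x * (grad (\<lambda>y. ln (\<rho> y)) x \<bullet> grad \<phi> x))) (at 0)"
    by (simp only:)
  show "partial_deriv j (entropy_force \<rho> i) x = entropy_hessian \<rho> i j x" if "x \<in> cell V" for x i j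
    using assms(2) that cell_subset_region unfolding smooth_density_def
    by (intro partial_deriv_entropy_force[OF _ open_region[OF assms(1)]]) auto
qed

end
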